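(* Let $A\in\mathbb{R}^{m\times n}$ and let $R:\mathbb{R}^n\to\mathbb{R}\cup\{+\infty\}$ be closed, proper and convex. For $b\in\mathbb{R}^m$ and $\lambda>0$ consider the regularized least-squares problem $$\min_{x\in\mathbb{R}^n}\ \tfrac12\|Ax-b\|^2+\lambda R(x),\qquad (P_{b,\lambda})$$ and its value function $$p:(b,\lambda)\in\mathbb{R}^m\times\mathbb{R}_+\mapsto \inf_{x\in\mathbb{R}^n}\left\{\tfrac12\|Ax-b\|^2+\lambda R(x)\right\},$$ where for $\lambda=0$ one sets $0\cdot R:=\delta_{\mathrm{cl}(\mathrm{dom}\,R)}$. Then the following hold: (a) (Existence of solutions) If $R^\infty(x)>0$ for all $x\in\ker A\setminus\{0\}$, then $(P_{b,\lambda})$ has a solution for all $(b,\lambda)\in\mathbb{R}^m\times\mathbb{R}_{++}$. (b) (Differentiability of value function) Let $(\bar b,\bar\lambda)\in\mathbb{R}^m\times\mathbb{R}_{++}$ and let $\bar x$ be a solution of $(P_{\bar b,\bar\lambda})$. Then $p$ is differentiable at $(\bar b,\bar\lambda)$ with $$\nabla p(\bar b,\bar\lambda)=\begin{pmatrix}\bar b-A\bar x\\ R(\bar x)\end{pmatrix}.$$ Moreover, if $(P_{b,\lambda})$ has a solution for all $(b,\lambda)$ in some neighborhood $U$ of $(\bar b,\bar\lambda)$, then $p$ is continuously differentiable on $U$. (c) (Continuity of value function to the boundary) Assume that $\mathrm{rge}\,A^T\cap\mathrm{dom}\,R^*\neq\emptyset$. Then $p$ is continuous at $(\bar b,0)$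 for any $\bar b\in\mathbb{R}^m$ in the sense that $$p(b,\lambda)\to\inf_{x\in\mathrm{cl}(\mathrm{dom}\,R)}\tfrac12\|Ax-\bar b\|^2\quad\text{as}\quad(b,\lambda)\to(\bar b,0).$$ (d) (Convexity of value function) $p$ is convex as a function of $b$ and concave as a function of $\lambda$. (e) (Constancy of residual and regularizer value) Given $(\bar b,\bar\lambda)\in\mathbb{R}^m\times\mathbb{R}_{++}$, the residual $\bar b-A\bar x$ and the regularizer value $R(\bar x)$ do not depend on the particular solution $\bar x$ of $(P_{\bar b,\bar\lambda})$.
   Context: $\|\cdot\|$ is the Euclidean norm, $\mathbb{R}_+=[0,\infty)$, $\mathbb{R}_{++}=(0,\infty)$. $\mathrm{dom}\,R=\{x: R(x)<+\infty\}$, $\mathrm{cl}$ denotes closure, $\mathrm{rge}\,A^T$ is the range of $A^T$. $\delta_S$ is the indicator function of a set $S$ ($0$ on $S$, $+\infty$ otherwise). $R^*(y)=\sup_{x}\{\langle y,x\rangle-R(x)\}$ is the Fenchel conjugate. $R^\infty$ is the recession (horizon) function of $R$: for any $\bar x\in\mathrm{dom}\,R$, $R^\infty(x)=\sup_{t>0}\frac{R(\bar x+tx)-R(\bar x)}{t}$. The infimum may take the value $-\infty$; convexity and concavity are in the extended-real-valued sense. *)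

theory Defs
  imports "HOL-Analysis.Analysis"
begin

section \<open>Extended-real-valued convex functions\<close>

definition edom :: "('a \<Rightarrow> ereal) \<Rightarrow> 'a set" where
  "edom f = {x. f x < \<infinity>}"

definition eepi :: "'a set \<Rightarrow> ('a \<Rightarrow> ereal) \<Rightarrow> ('a \<times> real) set" where
  "eepi S f = {(x, r). x \<in> S \<and> f x \<le> ereal r}"

text \<open>Convexity is convexity of the epigraph, so that both infinite values are admitted and
  no expression of the form \<open>\<infinity> - \<infinity>\<close> has to be interpreted.\<close>

definition econvex_on :: "'a::real_vector set \<Rightarrow> ('a \<Rightarrow> ereal) \<Rightarrow> bool" where
  "econvex_on S f \<longleftrightarrow> convex (eepi S f)"

definition econcave_on :: "'a::real_vector set \<Rightarrow> ('a \<Rightarrow> ereal) \<Rightarrow> bool" where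
  "econcave_on S f \<longleftrightarrow> econvex_on S (\<lambda>x. - f x)"

definition eproper :: "('a \<Rightarrow> ereal) \<Rightarrow> bool" where
  "eproper f \<longleftrightarrow> (\<forall>x. f x \<noteq> -\<infinity>) \<and> edom f \<noteq> {}"

text \<open>For a proper function, being closed is the same as lower semicontinuity, i.e. closedness
  of the epigraph.\<close>

definition eclosed :: "('a::topological_space \<Rightarrow> ereal) \<Rightarrow> bool" where
  "eclosed f \<longleftrightarrow> closed (eepi UNIV f)"

definition set_indicator :: "'a set \<Rightarrow> 'a \<Rightarrow> ereal" where
  "set_indicator S x = (if x \<in> S then 0 else \<infinity>)"

definition conjugate :: "('a::real_inner \<Rightarrow> ereal) \<Rightarrow> 'a \<Rightarrow> ereal" where
  "conjugate f y = (SUP x. ereal (y \<bullet> x) - f x)"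

definition recession_at :: "('a::real_vector \<Rightarrow> ereal) \<Rightarrow> 'a \<Rightarrow> 'a \<Rightarrow> ereal" where
  "recession_at f u x = (SUP t\<in>{0<..}. (f (u + t *\<^sub>R x) - f u) / ereal t)"

text \<open>The choice of the base point is immaterial for closed proper convex functions; see
  \<open>recession_eq\<close> below.\<close>

definition recession :: "('a::real_vector \<Rightarrow> ereal) \<Rightarrow> 'a \<Rightarrow> ereal" where
  "recession f = recession_at f (SOME u. u \<in> edom f)"

lemma recession_at_le_iff:
  assumes "eproper f" "u \<in> edom f"
  shows "recession_at f u x \<le> ereal v \<longleftrightarrow> (\<forall>t>0. f (u + t *\<^sub>R x) \<le> f u + ereal (t * v))"
proof -
  obtain a where a: "f u = ereal a"
    using assms by (cases "f u") (auto simp: eproper_def edom_def)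
  have "(f (u + t *\<^sub>R x) - f u) / ereal t \<le> ereal v \<longleftrightarrow> f (u + t *\<^sub>R x) \<le> f u + ereal (t * v)"
    if "t > 0" for t
    using that assms(1)
    by (cases "f (u + t *\<^sub>R x)") (auto simp: a eproper_def field_simps)
  then show ?thesis
    by (auto simp: recession_at_def SUP_le_iff)
qed

lemma recession_at_mono_base:
  fixes f :: "'a::real_normed_vector \<Rightarrow> ereal"
  assumes f: "eproper f" "eclosed f" "econvex_on UNIV f"
    and u: "u \<in> edom f" and w: "w \<in> edom f"
  shows "recession_at f w x \<le> recession_at f u x"
proof (rule ereal_le_real)
  fix v assume "recession_at f u x \<le> ereal v"
  then have le: "\<And>t. t > 0 \<Longrightarrow> f (u + t *\<^sub>R x) \<le> f u + ereal (t * v)"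
    using recession_at_le_iff[OF f(1) u] by auto
  obtain a c where a: "f u = ereal a" and c: "f w = ereal c"
    using f(1) u w by (cases "f u"; cases "f w") (auto simp: eproper_def edom_def)
  have "f (w + t *\<^sub>R x) \<le> f w + ereal (t * v)" if t: "t > 0" for t
  proof -
    define s where "s n = inverse (real (Suc n))" for n
    define z where "z n = (1 - s n) *\<^sub>R (w, c) + s n *\<^sub>R (u + (t / s n) *\<^sub>R x, a + t / s n * v)" for n
    have s: "0 < s n" "s n \<le> 1" for n
      by (auto simp: s_def field_simps)
    have "z n \<in> eepi UNIV f" for n
    proof -
      have "(w, c) \<in> eepi UNIV f"
        by (simp add: eepi_def c)
      moreover have "(u + (t / s n) *\<^sub>R x, a + t / s n * v) \<in> eepi UNIV f"
        using le[of "t / s n"] s[of n] t by (simp add: eepi_def a)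
      ultimately show ?thesis
        using f(3) s[of n] unfolding z_def econvex_on_def by (intro convexD) auto
    qed
    moreover have "z n = ((1 - s n) *\<^sub>R w + s n *\<^sub>R u + t *\<^sub>R x, (1 - s n) * c + s n * a + t * v)" for n
      using s(1)[of n] by (simp add: z_def algebra_simps)
    moreover have "s \<longlonglongrightarrow> 0"
      unfolding s_def by (rule LIMSEQ_inverse_real_of_nat)
    then have "(\<lambda>n. ((1 - s n) *\<^sub>R w + s n *\<^sub>R u + t *\<^sub>R x, (1 - s n) * c + s n * a + t * v))
        \<longlonglongrightarrow> ((1 - 0) *\<^sub>R w + 0 *\<^sub>R u + t *\<^sub>R x, (1 - 0) * c + 0 * a + t * v)"
      by (intro tendsto_intros)
    ultimately have "(w + t *\<^sub>R x, c + t * v) \<in> eepi UNIV f"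
      using f(2) unfolding eclosed_def closed_sequential_limits
      by (metis (no_types, lifting) ext diff_zero scaleR_one scaleR_zero_left add.right_neutral mult_1 mult_zero_left)
    then show ?thesis
      by (simp add: eepi_def c)
  qed
  then show "recession_at f w x \<le> ereal v"
    using recession_at_le_iff[OF f(1) w] by auto
qed

lemma recession_eq:
  fixes f :: "'a::real_normed_vector \<Rightarrow> ereal"
  assumes "eproper f" "eclosed f" "econvex_on UNIV f" "u \<in> edom f"
  shows "recession f x = recession_at f u x"
proof -
  have "(SOME u. u \<in> edom f) \<in> edom f"
    using assms(4) by (rule someI)
  then show ?thesis
    unfolding recession_def using assms by (intro antisym recession_at_mono_base)
qed

text \<open>Differentiability of an extended-real-valued function at a point requires finiteness
  near that point; \<^const>\<open>real_of_ereal\<close> alone would map infinite values to 0.\<close>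

definition has_egradient :: "('a::real_inner \<Rightarrow> ereal) \<Rightarrow> 'a \<Rightarrow> 'a \<Rightarrow> bool" where
  "has_egradient f g u \<longleftrightarrow>
     (\<forall>\<^sub>F v in nhds u. \<bar>f v\<bar> \<noteq> \<infinity>) \<and> (GDERIV (\<lambda>v. real_of_ereal (f v)) u :> g)"

definition continuously_differentiable_on :: "'a::real_inner set \<Rightarrow> ('a \<Rightarrow> ereal) \<Rightarrow> bool" where
  "continuously_differentiable_on U f \<longleftrightarrow>
     (\<exists>g. (\<forall>u\<in>U. has_egradient f (g u) u) \<and> continuous_on U g)"

section \<open>Regularized least squares\<close>

text \<open>In \<^typ>\<open>ereal\<close> one has \<open>0 * \<infinity> = 0\<close>, so the convention for
  \<open>0 \<cdot> R\<close> has to be built in explicitly.\<close>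

definition escale :: "real \<Rightarrow> ('a::topological_space \<Rightarrow> ereal) \<Rightarrow> 'a \<Rightarrow> ereal" where
  "escale l R x = (if l = 0 then set_indicator (closure (edom R)) x else ereal l * R x)"

definition rls_objective ::
  "real^'n^'m \<Rightarrow> (real^'n \<Rightarrow> ereal) \<Rightarrow> real^'m \<Rightarrow> real \<Rightarrow> real^'n \<Rightarrow> ereal" where
  "rls_objective A R b l x = ereal (1/2 * (norm (A *v x - b))\<^sup>2) + escale l R x"

definition rls_solution ::
  "real^'n^'m \<Rightarrow> (real^'n \<Rightarrow> ereal) \<Rightarrow> real^'m \<Rightarrow> real \<Rightarrow> real^'n \<Rightarrow> bool" where
  "rls_solution A R b l x \<longleftrightarrow> is_arg_min (rls_objective A R b l) (\<lambda>_. True) x"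

text \<open>The value function is meaningful only for \<open>l \<ge> 0\<close>; the values for negative \<open>l\<close> are
  junk.\<close>

definition rls_value ::
  "real^'n^'m \<Rightarrow> (real^'n \<Rightarrow> ereal) \<Rightarrow> (real^'m) \<times> real \<Rightarrow> ereal" where
  "rls_value A R = (\<lambda>(b, l). INF x. rls_objective A R b l x)"

end

theory Submission
  imports Defs
begin

text \<open>
  Existence.  For \<open>l > 0\<close> the objective is closed and convex, so it suffices that its sublevel
  sets are bounded.  An unbounded one contains a ray.  Its direction must lie in the kernel of \<open>A\<close>,
  as otherwise \<open>R\<close> would decrease quadratically along the ray, and then \<open>R\<close> does not grow along
  it, against the recession condition.

  Differentiability.  At a solution \<open>x'\<close> for the parameters \<open>(b', l')\<close>, with residual
  \<open>r = b' - A x'\<close>, the vector \<open>A\<^sup>T r / l'\<close> is a subgradient of \<open>R\<close>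
  (\<open>rls_solution_subgradient\<close>).  Keeping \<open>x'\<close> fixed gives a smooth majorant of the value
  function; replacing \<open>R\<close> by its affine minorant at \<open>x'\<close>, and \<open>A x\<close> by an
  unconstrained vector, gives a smooth minorant.  Their
  difference is \<open>1/2 \<parallel>(b - A x') - (l/l') r\<parallel>\<^sup>2\<close>, which vanishes to second order at
  \<open>(b', l')\<close>, so the value function is squeezed between functions with the same derivative
  there (\<open>rls_value_bounds\<close>).  In particular no solvability at neighbouring parameters is needed.

  Continuity of the gradient and uniqueness of the residual.  Adding the subgradient inequalities
  at two solutions bounds the distance of the scaled residuals \<open>(b - A x) / l\<close> by the distance
  of the parameters (\<open>rls_solution_scaled_residual\<close>); the same two inequalities then control
  the values of \<open>R\<close>.

  Boundary behaviour.  A point \<open>A\<^sup>T v\<close> in the domain of the conjugate is the slope of an affine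
  minorant \<open>x \<mapsto> \<langle>v, A x\<rangle> - c\<close> of \<open>R\<close>.  Completing the square, the value function is bounded
  below by half the squared distance of \<open>b - l v\<close> to the image of the closed domain, up to terms
  of order \<open>l\<close>; this is continuous in \<open>(b, l)\<close>.  The upper bound comes from evaluating the
  objective at points of the domain.

  Convexity in \<open>b\<close> holds because the objective is jointly convex in \<open>(b, x)\<close>; concavity in
  \<open>l\<close> because the value function is an infimum of functions that are concave in \<open>l\<close>.
\<close>

section \<open>Extended-real-valued convex functions\<close>

lemma econvex_onD:
  assumes "econvex_on S f" "x \<in> S" "y \<in> S" "f x \<le> ereal r" "f y \<le> ereal s" "0 \<le> t" "t \<le> 1"
  shows "f ((1 - t) *\<^sub>R x + t *\<^sub>R y) \<le> ereal ((1 - t) * r + t * s)"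
proof -
  have "(x, r) \<in> eepi S f" "(y, s) \<in> eepi S f"
    using assms by (auto simp: eepi_def)
  then have "(1 - t) *\<^sub>R (x, r) + t *\<^sub>R (y, s) \<in> eepi S f"
    using assms unfolding econvex_on_def convex_alt by blast
  then show ?thesis
    by (simp add: eepi_def)
qed

lemma convex_edom:
  assumes "econvex_on UNIV f"
  shows "convex (edom f)"
  unfolding convex_alt
proof (intro ballI allI impI)
  fix x y and t :: real
  assume x: "x \<in> edom f" and y: "y \<in> edom f" and t: "0 \<le> t \<and> t \<le> 1"
  obtain r s where "f x \<le> ereal r" "f y \<le> ereal s"
    using x y unfolding edom_def by (metis less_ereal.simps(2) less_imp_le ereal_dense2 mem_Collect_eq)
  then have "f ((1 - t) *\<^sub>R x + t *\<^sub>R y) \<le> ereal ((1 - t) * r + t * s)"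
    using econvex_onD[OF assms] t by auto
  then show "(1 - t) *\<^sub>R x + t *\<^sub>R y \<in> edom f"
    by (auto simp: edom_def intro: le_less_trans)
qed

lemma closed_sublevel:
  assumes "eclosed f" "continuous_on UNIV h"
  shows "closed {x. f x \<le> ereal (h x)}"
proof -
  have "closed ((\<lambda>x. (x, h x)) -` eepi UNIV f)"
    using assms unfolding eclosed_def by (intro closed_vimage continuous_intros) auto
  also have "(\<lambda>x. (x, h x)) -` eepi UNIV f = {x. f x \<le> ereal (h x)}"
    by (auto simp: eepi_def)
  finally show ?thesis .
qed

lemma eproper_cases [consumes 1, case_names real infinite]:
  assumes "eproper f"
  obtains (real) c where "f x = ereal c" | (infinite) "f x = \<infinity>"
  using assms by (cases "f x") (auto simp: eproper_def)

text \<open>The nonempty sublevel sets form a chain of compact sets, and the points of their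
  intersection are the minimizers.\<close>

lemma exists_minimizer_of_compact_sublevels:
  fixes f :: "'a::heine_borel \<Rightarrow> ereal"
  assumes compact: "\<And>r. compact {x. f x \<le> ereal r}" and "f u < \<infinity>"
  shows "\<exists>x. is_arg_min f (\<lambda>_. True) x"
proof -
  define L where "L r = {x. f x \<le> ereal r}" for r
  define I where "I = {r. L r \<noteq> {}}"
  obtain a where a: "f u \<le> ereal a"
    using assms(2) by (metis ereal_dense2 less_imp_le)
  have "L a \<inter> \<Inter> (L ` I) \<noteq> {}"
  proof (rule compact_imp_fip_image)
    show "compact (L a)"
      by (simp add: L_def compact)
    show "closed (L r)" for r
      by (simp add: L_def compact compact_imp_closed)
    fix J assume J: "finite J" "J \<subseteq> I"
    have "a \<in> I"
      using a by (auto simp: I_def L_def)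
    then have "Min (insert a J) \<in> I"
      using J Min_in[of "insert a J"] by (auto simp del: Min_insert)
    then obtain x where "f x \<le> ereal (Min (insert a J))"
      by (auto simp: I_def L_def)
    moreover have "Min (insert a J) \<le> r" if "r \<in> insert a J" for r
      using J(1) that by (intro Min_le) auto
    ultimately have "f x \<le> ereal r" if "r \<in> insert a J" for r
      using that by (meson ereal_less_eq(3) order_trans)
    then have "x \<in> L a \<inter> \<Inter> (L ` J)"
      by (auto simp: L_def)
    then show "L a \<inter> \<Inter> (L ` J) \<noteq> {}"
      by blast
  qed
  then obtain x where x: "\<And>r. r \<in> I \<Longrightarrow> f x \<le> ereal r"
    by (auto simp: L_def)
  have "\<not> f y < f x" for y
  proof
    assume "f y < f x"
    then obtain r where r: "f y < ereal r" "ereal r < f x"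
      using ereal_dense2 by blast
    then have "r \<in> I"
      by (auto simp: I_def L_def intro!: exI[of _ y])
    then show False
      using x r by fastforce
  qed
  then show ?thesis
    by (auto simp: is_arg_min_def)
qed

section \<open>The regularized objective\<close>

lemma escale_le_iff:
  assumes "0 < l"
  shows "escale l R x \<le> ereal r \<longleftrightarrow> R x \<le> ereal (r / l)"
  using assms by (cases "R x") (auto simp: escale_def field_simps)

lemma econvex_on_escale:
  fixes R :: "'a::real_normed_vector \<Rightarrow> ereal"
  assumes "econvex_on UNIV R" "0 \<le> l"
  shows "econvex_on UNIV (escale l R)"
  unfolding econvex_on_def convex_alt
proof (intro ballI allI impI)
  fix p q and t :: real
  assume pq: "p \<in> eepi UNIV (escale l R)" "q \<in> eepi UNIV (escale l R)" and t: "0 \<le> t \<and> t \<le> 1"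
  obtain x r y s where [simp]: "p = (x, r)" "q = (y, s)"
    by (cases p; cases q)
  have le: "escale l R x \<le> ereal r" "escale l R y \<le> ereal s"
    using pq by (auto simp: eepi_def)
  have "escale l R ((1 - t) *\<^sub>R x + t *\<^sub>R y) \<le> ereal ((1 - t) * r + t * s)"
  proof (cases "l = 0")
    case True
    then have "x \<in> closure (edom R)" "0 \<le> r" "y \<in> closure (edom R)" "0 \<le> s"
      using le by (auto simp: escale_def set_indicator_def split: if_splits)
    moreover have "convex (closure (edom R))"
      by (intro convex_closure convex_edom assms)
    ultimately have "(1 - t) *\<^sub>R x + t *\<^sub>R y \<in> closure (edom R)" "0 \<le> (1 - t) * r + t * s"
      using t unfolding convex_alt by auto
    then show ?thesis
      using True by (simp add: escale_def set_indicator_def)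
  next
    case False
    then have l: "0 < l"
      using assms by simp
    have "R ((1 - t) *\<^sub>R x + t *\<^sub>R y) \<le> ereal ((1 - t) * (r / l) + t * (s / l))"
      using le t by (intro econvex_onD[OF assms(1)]) (auto simp: escale_le_iff[OF l])
    then show ?thesis
      by (simp add: escale_le_iff[OF l] add_divide_distrib)
  qed
  then show "(1 - t) *\<^sub>R p + t *\<^sub>R q \<in> eepi UNIV (escale l R)"
    by (simp add: eepi_def)
qed

lemma rls_objective_le_iff_escale:
  "rls_objective A R b l x \<le> ereal r \<longleftrightarrow>
     escale l R x \<le> ereal (r - 1/2 * (norm (A *v x - b))\<^sup>2)"
  by (cases "escale l R x") (auto simp: rls_objective_def)

lemma rls_objective_le_iff:
  assumes "0 < l"
  shows "rls_objective A R b l x \<le> ereal r \<longleftrightarrow>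
     R x \<le> ereal ((r - 1/2 * (norm (A *v x - b))\<^sup>2) / l)"
  using assms by (simp add: rls_objective_le_iff_escale escale_le_iff)

lemma rls_objective_real:
  assumes "R x = ereal c"
  shows "rls_objective A R b l x = ereal (1/2 * (norm (A *v x - b))\<^sup>2 + l * c)"
proof -
  have "x \<in> closure (edom R)"
    using assms closure_subset[of "edom R"] by (auto simp: edom_def)
  then show ?thesis
    using assms by (auto simp: rls_objective_def escale_def set_indicator_def)
qed

lemma rls_objective_infinite:
  assumes "R x = \<infinity>" "0 < l"
  shows "rls_objective A R b l x = \<infinity>"
  using assms by (simp add: rls_objective_def escale_def)

lemma half_norm_sq_convex:
  fixes u v :: "'a::real_inner"
  assumes "0 \<le> t" "t \<le> 1"
  shows "1/2 * (norm ((1 - t) *\<^sub>R u + t *\<^sub>R v))\<^sup>2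
    \<le> (1 - t) * (1/2 * (norm u)\<^sup>2) + t * (1/2 * (norm v)\<^sup>2)"
proof -
  have "(1 - t) * (1/2 * (norm u)\<^sup>2) + t * (1/2 * (norm v)\<^sup>2)
      - 1/2 * (norm ((1 - t) *\<^sub>R u + t *\<^sub>R v))\<^sup>2 = t * (1 - t) / 2 * (norm (u - v))\<^sup>2"
    unfolding power2_norm_eq_inner
    by (simp add: algebra_simps inner_commute) (simp add: field_simps)
  moreover have "0 \<le> t * (1 - t) / 2 * (norm (u - v))\<^sup>2"
    using assms by simp
  ultimately show ?thesis
    by linarith
qed

lemma norm_sq_add_scaleR:
  fixes u v :: "'a::real_inner"
  shows "(norm (u + t *\<^sub>R v))\<^sup>2 = (norm u)\<^sup>2 + 2 * t * (u \<bullet> v) + t\<^sup>2 * (norm v)\<^sup>2"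
  unfolding power2_norm_eq_inner
  by (simp add: inner_add_left inner_add_right inner_commute algebra_simps power2_eq_square)

lemma matrix_vector_convex_comb:
  fixes A :: "real^'n^'m"
  shows "A *v ((1 - t) *\<^sub>R x + t *\<^sub>R y) = (1 - t) *\<^sub>R (A *v x) + t *\<^sub>R (A *v y)"
  by (simp add: matrix_vector_right_distrib matrix_vector_mult_scaleR)

text \<open>The objective is jointly convex in the data vector and the variable.\<close>

lemma rls_objective_jointly_convex:
  assumes "econvex_on UNIV R" "0 \<le> l"
    and "rls_objective A R b l x \<le> ereal r" "rls_objective A R c l y \<le> ereal s"
    and t: "0 \<le> t" "t \<le> 1"
  shows "rls_objective A R ((1 - t) *\<^sub>R b + t *\<^sub>R c) l ((1 - t) *\<^sub>R x + t *\<^sub>R y)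
    \<le> ereal ((1 - t) * r + t * s)"
proof -
  let ?z = "(1 - t) *\<^sub>R x + t *\<^sub>R y" and ?d = "(1 - t) *\<^sub>R b + t *\<^sub>R c"
  have "escale l R ?z \<le> ereal ((1 - t) * (r - 1/2 * (norm (A *v x - b))\<^sup>2)
      + t * (s - 1/2 * (norm (A *v y - c))\<^sup>2))"
    using assms by (intro econvex_onD[OF econvex_on_escale]) (auto simp: rls_objective_le_iff_escale)
  moreover have "A *v ?z - ?d = (1 - t) *\<^sub>R (A *v x - b) + t *\<^sub>R (A *v y - c)"
    by (simp add: matrix_vector_convex_comb algebra_simps)
  then have "(1 - t) * (r - 1/2 * (norm (A *v x - b))\<^sup>2)
      + t * (s - 1/2 * (norm (A *v y - c))\<^sup>2)
      \<le> (1 - t) * r + t * s - 1/2 * (norm (A *v ?z - ?d))\<^sup>2"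
    using half_norm_sq_convex[OF t, of "A *v x - b" "A *v y - c"]
    by (simp add: right_diff_distrib)
  ultimately show ?thesis
    unfolding rls_objective_le_iff_escale by (meson ereal_less_eq(3) order_trans)
qed

section \<open>Existence of solutions\<close>

text \<open>Quadratic decrease along a ray is impossible for a convex function that is finite at the
  origin of the ray and nowhere \<open>-\<infinity>\<close>.\<close>

lemma econvex_no_quadratic_decrease:
  fixes f :: "'a::real_vector \<Rightarrow> ereal"
  assumes f: "eproper f" "econvex_on UNIV f" and k: "0 < k"
    and "f u \<le> ereal a"
    and decr: "\<And>t. 0 < t \<Longrightarrow> f (u + t *\<^sub>R d) \<le> ereal (c + t * e - k * t\<^sup>2)"
  shows False
proof -
  have le: "f (u + d) \<le> ereal (\<bar>a\<bar> + \<bar>c\<bar> + e - k * t)" if t: "1 \<le> t" for t :: real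
  proof -
    have "f ((1 - 1/t) *\<^sub>R u + (1/t) *\<^sub>R (u + t *\<^sub>R d))
        \<le> ereal ((1 - 1/t) * a + (1/t) * (c + t * e - k * t\<^sup>2))"
      using t assms(4) decr[of t] by (intro econvex_onD[OF f(2)]) auto
    moreover have "(1 - 1/t) *\<^sub>R u + (1/t) *\<^sub>R (u + t *\<^sub>R d) = u + d"
      using t by (simp add: algebra_simps)
    moreover have "(1 - 1/t) * a + (1/t) * (c + t * e - k * t\<^sup>2) \<le> \<bar>a\<bar> + \<bar>c\<bar> + e - k * t"
    proof -
      have "p * v \<le> \<bar>v\<bar>" if "0 \<le> p" "p \<le> 1" for p v :: real
        using mult_left_mono[OF abs_ge_self that(1), of v] mult_right_mono[OF that(2), of "\<bar>v\<bar>"]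
        by simp
      from this[of "1 - 1/t" a] this[of "1/t" c]
      have "(1 - 1/t) * a \<le> \<bar>a\<bar>" "(1/t) * c \<le> \<bar>c\<bar>"
        using t by simp_all
      moreover have "(1/t) * (c + t * e - k * t\<^sup>2) = (1/t) * c + e - k * t"
        using t by (simp add: field_simps power2_eq_square)
      ultimately show ?thesis
        by linarith
    qed
    ultimately show ?thesis
      by (metis ereal_less_eq(3) order_trans)
  qed
  obtain v where v: "f (u + d) = ereal v"
    using f(1) le[of 1] by (cases "f (u + d)") (auto simp: eproper_def)
  \<comment> \<open>so large that the upper bound just found drops below \<open>v\<close>\<close>
  define t where "t = max 1 ((\<bar>a\<bar> + \<bar>c\<bar> + e - v + 1) / k)"
  have "(\<bar>a\<bar> + \<bar>c\<bar> + e - v + 1) / k \<le> t"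
    by (simp add: t_def)
  then have "\<bar>a\<bar> + \<bar>c\<bar> + e - v + 1 \<le> k * t"
    using k by (simp add: field_simps)
  moreover have "v \<le> \<bar>a\<bar> + \<bar>c\<bar> + e - k * t"
    using le[of t] v by (simp add: t_def)
  ultimately show False
    by linarith
qed

lemma closed_rls_sublevel:
  assumes "eclosed R" "0 < l"
  shows "closed {x. rls_objective A R b l x \<le> ereal r}"
  unfolding rls_objective_le_iff[OF assms(2)]
  by (intro closed_sublevel assms continuous_intros) (use assms in auto)

text \<open>An unbounded sublevel set contains a ray.  Its direction lies in the kernel, since otherwise
  the regularizer would decrease quadratically along the ray, and it is therefore a direction in
  which the regularizer does not grow.\<close>

lemma bounded_rls_sublevel:
  fixes A :: "real^'n^'m"
  assumes R: "eproper R" "eclosed R" "econvex_on UNIV R"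
    and rec: "\<And>x. A *v x = 0 \<Longrightarrow> x \<noteq> 0 \<Longrightarrow> recession R x > 0"
    and l: "0 < l"
  shows "bounded {x. rls_objective A R b l x \<le> ereal r}"
proof (rule ccontr)
  define L where "L = {x. rls_objective A R b l x \<le> ereal r}"
  assume "\<not> bounded {x. rls_objective A R b l x \<le> ereal r}"
  then have unb: "\<not> bounded L"
    by (simp add: L_def)
  then have "L \<noteq> {}"
    by auto
  then obtain u where u: "u \<in> L"
    by blast
  have "\<exists>x\<in>L. real (Suc n) < norm (x - u)" for n
  proof (rule ccontr)
    assume "\<not> ?thesis"
    then have "L \<subseteq> cball u (real (Suc n))"
      by (auto simp: dist_norm norm_minus_commute not_less)
    then show False
      using unb bounded_cball bounded_subset by blast
  qed
  then obtain x where x: "\<And>n. x n \<in> L" "\<And>n. real (Suc n) < norm (x n - u)"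
    by metis
  define d where "d n = (x n - u) /\<^sub>R norm (x n - u)" for n
  have npos: "0 < norm (x n - u)" for n
    using x(2)[of n] by linarith
  have "\<forall>n. d n \<in> sphere 0 1"
  proof
    fix n
    show "d n \<in> sphere 0 1"
      using npos[of n] by (simp add: d_def)
  qed
  then obtain dd \<phi> where dd: "dd \<in> sphere 0 1" "strict_mono \<phi>" "(d \<circ> \<phi>) \<longlonglongrightarrow> dd"
    using compact_sphere[of 0 1] unfolding compact_def by metis
  have closed: "closed L"
    unfolding L_def by (rule closed_rls_sublevel[OF R(2) l])
  have ray: "u + t *\<^sub>R dd \<in> L" if t: "0 < t" for t
  proof -
    have "\<forall>\<^sub>F n in sequentially. u + t *\<^sub>R (d \<circ> \<phi>) n \<in> L"
    proof (rule eventually_sequentiallyI[of "nat \<lceil>t\<rceil>"])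
      fix n assume "nat \<lceil>t\<rceil> \<le> n"
      then have "t \<le> real n"
        by linarith
      also have "real n \<le> real (\<phi> n)"
        using seq_suble[OF dd(2)] by simp
      also have "\<dots> < norm (x (\<phi> n) - u)"
        using x(2)[of "\<phi> n"] by simp
      finally have lt: "t < norm (x (\<phi> n) - u)" .
      define s where "s = t / norm (x (\<phi> n) - u)"
      have s: "0 \<le> s" "s \<le> 1"
        using lt t by (auto simp: s_def divide_simps)
      have "rls_objective A R ((1 - s) *\<^sub>R b + s *\<^sub>R b) l ((1 - s) *\<^sub>R u + s *\<^sub>R x (\<phi> n))
          \<le> ereal ((1 - s) * r + s * r)"
        using u x(1)[of "\<phi> n"] s l
        by (intro rls_objective_jointly_convex R) (auto simp: L_def)
      then have "(1 - s) *\<^sub>R u + s *\<^sub>R x (\<phi> n) \<in> L"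
        by (simp add: L_def algebra_simps)
      moreover have "(1 - s) *\<^sub>R u + s *\<^sub>R x (\<phi> n) = u + t *\<^sub>R (d \<circ> \<phi>) n"
        by (simp add: d_def s_def algebra_simps divide_inverse)
      ultimately show "u + t *\<^sub>R (d \<circ> \<phi>) n \<in> L"
        by simp
    qed
    moreover have "(\<lambda>n. u + t *\<^sub>R (d \<circ> \<phi>) n) \<longlonglongrightarrow> u + t *\<^sub>R dd"
      by (intro tendsto_intros dd)
    ultimately show ?thesis
      using closed by (intro Lim_in_closed_set[where F = sequentially]) auto
  qed
  have uR: "R u \<le> ereal ((r - 1/2 * (norm (A *v u - b))\<^sup>2) / l)"
    using u by (simp add: L_def rls_objective_le_iff[OF l])
  then obtain a where a: "R u = ereal a"
    using R(1) by (cases "R u") (auto simp: eproper_def)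
  let ?q = "A *v u - b" and ?w = "A *v dd"
  have rayR: "R (u + t *\<^sub>R dd) \<le> ereal ((r - 1/2 * (norm (?q + t *\<^sub>R ?w))\<^sup>2) / l)" if "0 < t" for t
    using ray[OF that]
    by (simp add: L_def rls_objective_le_iff[OF l] matrix_vector_right_distrib
        matrix_vector_mult_scaleR algebra_simps)
  have ker: "?w = 0"
  proof (rule ccontr)
    assume w: "?w \<noteq> 0"
    have expand: "(r - 1/2 * (norm (?q + t *\<^sub>R ?w))\<^sup>2) / l
      = (r - 1/2 * (norm ?q)\<^sup>2) / l + t * (- (?q \<bullet> ?w) / l) - ((norm ?w)\<^sup>2 / (2 * l)) * t\<^sup>2" for t
      using l unfolding norm_sq_add_scaleR by (simp add: field_simps)
    show False
    proof (rule econvex_no_quadratic_decrease[OF R(1,3)])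
      show "0 < (norm ?w)\<^sup>2 / (2 * l)"
        using w l by simp
      show "R u \<le> ereal a"
        by (simp add: a)
      show "R (u + t *\<^sub>R dd) \<le> ereal ((r - 1/2 * (norm ?q)\<^sup>2) / l
          + t * (- (?q \<bullet> ?w) / l) - ((norm ?w)\<^sup>2 / (2 * l)) * t\<^sup>2)" if "0 < t" for t
        using rayR[OF that] unfolding expand .
    qed
  qed
  define c where "c = (r - 1/2 * (norm ?q)\<^sup>2) / l"
  have bd: "R (u + t *\<^sub>R dd) \<le> ereal c" if "0 < t" for t
    using rayR[OF that] ker by (simp add: c_def)
  have "R (u + t *\<^sub>R dd) \<le> R u + ereal (t * 0)" if t: "0 < t" for t
  proof -
    \<comment> \<open>a convex function that is bounded above along a ray is nonincreasing along it\<close>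
    have le: "R (u + t *\<^sub>R dd) \<le> ereal (a + s * (c - a))" if s: "0 < s" "s \<le> 1" for s
    proof -
      have "R ((1 - s) *\<^sub>R u + s *\<^sub>R (u + (t / s) *\<^sub>R dd)) \<le> ereal ((1 - s) * a + s * c)"
        using s t bd[of "t / s"] a by (intro econvex_onD[OF R(3)]) auto
      moreover have "(1 - s) *\<^sub>R u + s *\<^sub>R (u + (t / s) *\<^sub>R dd) = u + t *\<^sub>R dd"
        using s by (simp add: algebra_simps)
      moreover have "(1 - s) * a + s * c = a + s * (c - a)"
        by (simp add: algebra_simps)
      ultimately show ?thesis
        by metis
    qed
    obtain v where v: "R (u + t *\<^sub>R dd) = ereal v"
      using R(1) bd[OF t] by (cases "R (u + t *\<^sub>R dd)") (auto simp: eproper_def)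
    have "((\<lambda>s. a + s * (c - a)) \<longlongrightarrow> a + 0 * (c - a)) (at_right 0)"
      by (intro tendsto_intros)
    moreover have "\<forall>\<^sub>F s in at_right 0. v \<le> a + s * (c - a)"
      unfolding eventually_at_right_field using le v by (intro exI[of _ 1]) auto
    ultimately have "v \<le> a + 0 * (c - a)"
      by (intro tendsto_lowerbound) auto
    then show ?thesis
      by (simp add: v a)
  qed
  moreover have dom: "u \<in> edom R"
    by (simp add: edom_def a)
  ultimately have "recession_at R u dd \<le> ereal 0"
    using recession_at_le_iff[OF R(1) dom] by blast
  then have "recession R dd \<le> 0"
    using recession_eq[OF R dom] by (simp add: zero_ereal_def)
  moreover have "dd \<noteq> 0"
    using dd(1) by auto
  ultimately show False
    using rec[OF ker] by (simp add: not_less[symmetric])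
qed

lemma rls_solution_exists:
  fixes A :: "real^'n^'m"
  assumes R: "eproper R" "eclosed R" "econvex_on UNIV R"
    and rec: "\<And>x. A *v x = 0 \<Longrightarrow> x \<noteq> 0 \<Longrightarrow> recession R x > 0"
    and l: "0 < l"
  shows "\<exists>x. rls_solution A R b l x"
proof -
  obtain u where "R u < \<infinity>"
    using R(1) by (auto simp: eproper_def edom_def)
  then obtain c where "R u = ereal c"
    using eproper_cases[OF R(1)] by (metis less_irrefl)
  then have "rls_objective A R b l u < \<infinity>"
    by (simp add: rls_objective_real)
  moreover have "compact {x. rls_objective A R b l x \<le> ereal r}" for r
    using bounded_rls_sublevel[OF R rec l] closed_rls_sublevel[OF R(2) l] compact_eq_bounded_closed
    by blast
  ultimately show ?thesis
    unfolding rls_solution_def by (intro exists_minimizer_of_compact_sublevels) auto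
qed

section \<open>Optimality condition and differentiability of the value function\<close>

lemma rls_value_le: "rls_value A R (b, l) \<le> rls_objective A R b l x"
  by (simp add: rls_value_def INF_lower)

lemma rls_value_geI:
  assumes "\<And>x. r \<le> rls_objective A R b l x"
  shows "r \<le> rls_value A R (b, l)"
  by (simp add: rls_value_def INF_greatest assms)

lemma rls_solution_le:
  "rls_solution A R b l x \<Longrightarrow> rls_objective A R b l x \<le> rls_objective A R b l y"
  by (auto simp: rls_solution_def is_arg_min_def not_less)

lemma rls_solution_finite:
  assumes "eproper R" "rls_solution A R b l x" "0 < l"
  obtains a where "R x = ereal a"
proof -
  obtain u where "R u < \<infinity>"
    using assms(1) by (auto simp: eproper_def edom_def)
  then obtain c where "R u = ereal c"
    using eproper_cases[OF assms(1)] by (metis less_irrefl)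
  then have "rls_objective A R b l x \<noteq> \<infinity>"
    using rls_solution_le[OF assms(2), of u] by (auto simp: rls_objective_real)
  then show ?thesis
    using that rls_objective_infinite assms(3) eproper_cases[OF assms(1)] by metis
qed

text \<open>Fermat's rule: the vector \<open>A\<^sup>T (b - A x) / l\<close> is a subgradient of \<open>R\<close> at a
  solution \<open>x\<close>.\<close>

lemma rls_solution_subgradient:
  fixes A :: "real^'n^'m"
  assumes R: "econvex_on UNIV R" and l: "0 < l" and sol: "rls_solution A R b l x"
    and a: "R x = ereal a" and c: "R y = ereal c"
  shows "a + ((b - A *v x) /\<^sub>R l) \<bullet> (A *v y - A *v x) \<le> c"
proof -
  define r where "r = b - A *v x"
  define w where "w = A *v y - A *v x"
  have le: "r \<bullet> w \<le> t * (1/2 * (norm w)\<^sup>2) + l * (c - a)" if t: "0 < t" "t \<le> 1" for t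
  proof -
    let ?z = "(1 - t) *\<^sub>R x + t *\<^sub>R y"
    have "R ?z \<le> ereal ((1 - t) * a + t * c)"
      using t a c by (intro econvex_onD[OF R]) auto
    then have "rls_objective A R b l ?z
        \<le> ereal (1/2 * (norm (A *v ?z - b))\<^sup>2 + l * ((1 - t) * a + t * c))"
      by (simp add: rls_objective_le_iff[OF l] l less_imp_neq[OF l, symmetric])
    then have "1/2 * (norm (A *v x - b))\<^sup>2 + l * a
        \<le> 1/2 * (norm (A *v ?z - b))\<^sup>2 + l * ((1 - t) * a + t * c)"
      using rls_solution_le[OF sol, of ?z] unfolding rls_objective_real[of R x, OF a]
      by (meson ereal_less_eq(3) order_trans)
    moreover have "A *v ?z - b = - r + t *\<^sub>R w"
      unfolding matrix_vector_convex_comb by (simp add: r_def w_def algebra_simps)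
    then have "(norm (A *v ?z - b))\<^sup>2 = (norm r)\<^sup>2 - 2 * t * (r \<bullet> w) + t\<^sup>2 * (norm w)\<^sup>2"
      using norm_sq_add_scaleR[of "- r" t w] by simp
    moreover have "norm (A *v x - b) = norm r"
      by (simp add: r_def norm_minus_commute)
    ultimately have "t * (r \<bullet> w) \<le> t * (t * (1/2 * (norm w)\<^sup>2) + l * (c - a))"
      by (simp add: algebra_simps power2_eq_square)
    then show ?thesis
      using t by simp
  qed
  have "((\<lambda>t. t * (1/2 * (norm w)\<^sup>2) + l * (c - a))
      \<longlongrightarrow> 0 * (1/2 * (norm w)\<^sup>2) + l * (c - a)) (at_right 0)"
    by (intro tendsto_intros)
  moreover have "\<forall>\<^sub>F t in at_right 0. r \<bullet> w \<le> t * (1/2 * (norm w)\<^sup>2) + l * (c - a)"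
    unfolding eventually_at_right_field using le by (intro exI[of _ 1]) auto
  ultimately have "r \<bullet> w \<le> 0 * (1/2 * (norm w)\<^sup>2) + l * (c - a)"
    by (intro tendsto_lowerbound) auto
  then have "(r \<bullet> w) / l \<le> c - a"
    using l by (simp add: field_simps)
  then show ?thesis
    by (simp add: r_def w_def divide_inverse mult.commute)
qed

text \<open>The value function lies between the majorant obtained by keeping the solution \<open>x\<close> for
  \<open>(b', l')\<close> fixed and the minorant obtained by replacing \<open>R\<close> by its affine minorant at
  \<open>x\<close> and minimizing over an unconstrained vector in place of the image under \<open>A\<close>.\<close>

lemma rls_value_bounds:
  fixes A :: "real^'n^'m"
  assumes R: "eproper R" "econvex_on UNIV R"
    and l': "0 < l'" and sol: "rls_solution A R b' l' x" and a: "R x = ereal a" and l: "0 < l"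
  shows "rls_value A R (b, l) \<le> ereal (1/2 * (norm (b - A *v x))\<^sup>2 + l * a)"
    and "ereal (1/2 * (norm (b - A *v x))\<^sup>2 + l * a
        - 1/2 * (norm ((b - A *v x) - (l / l') *\<^sub>R (b' - A *v x)))\<^sup>2) \<le> rls_value A R (b, l)"
proof -
  show "rls_value A R (b, l) \<le> ereal (1/2 * (norm (b - A *v x))\<^sup>2 + l * a)"
    using rls_value_le[of A R b l x] by (simp add: rls_objective_real[of R x, OF a] norm_minus_commute)
  define v where "v = b - A *v x"
  define r where "r = b' - A *v x"
  define s where "s = l / l'"
  have "ereal (1/2 * (norm v)\<^sup>2 + l * a - 1/2 * (norm (v - s *\<^sub>R r))\<^sup>2) \<le> rls_objective A R b l y" for y
    using R(1)
  proof (cases rule: eproper_cases[where x = y])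
    case infinite
    then show ?thesis
      by (simp add: rls_objective_infinite l)
  next
    case (real c)
    define w where "w = A *v y - A *v x"
    have "a + (r /\<^sub>R l') \<bullet> w \<le> c"
      using rls_solution_subgradient[OF R(2) l' sol a real] by (simp add: r_def w_def)
    then have "l * (a + (r /\<^sub>R l') \<bullet> w) \<le> l * c"
      using l by simp
    then have "l * a + s * (r \<bullet> w) \<le> l * c"
      by (simp add: s_def algebra_simps divide_inverse)
    \<comment> \<open>completing the square in the image variable \<open>w\<close>\<close>
    moreover have "1/2 * (norm (w - v))\<^sup>2 + s * (r \<bullet> w) - (1/2 * (norm v)\<^sup>2 - 1/2 * (norm (v - s *\<^sub>R r))\<^sup>2)
        = 1/2 * (norm (w - v + s *\<^sub>R r))\<^sup>2"
      unfolding power2_norm_eq_inner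
      by (simp add: inner_add_left inner_add_right inner_diff_left inner_diff_right inner_commute algebra_simps)
    moreover have "0 \<le> 1/2 * (norm (w - v + s *\<^sub>R r))\<^sup>2"
      by simp
    ultimately have "1/2 * (norm v)\<^sup>2 + l * a - 1/2 * (norm (v - s *\<^sub>R r))\<^sup>2
        \<le> 1/2 * (norm (w - v))\<^sup>2 + l * c"
      by linarith
    moreover have "w - v = A *v y - b"
      by (simp add: w_def v_def)
    ultimately show ?thesis
      by (simp only: rls_objective_real[of R y, OF real] ereal_less_eq)
  qed
  then show "ereal (1/2 * (norm (b - A *v x))\<^sup>2 + l * a
        - 1/2 * (norm ((b - A *v x) - (l / l') *\<^sub>R (b' - A *v x)))\<^sup>2) \<le> rls_value A R (b, l)"
    unfolding v_def r_def s_def by (rule rls_value_geI)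
qed

lemma has_derivative_sandwich:
  fixes f g h :: "'a::real_normed_vector \<Rightarrow> real"
  assumes g: "(g has_derivative D) (at x)" and h: "(h has_derivative D) (at x)"
    and eq: "g x = f x" "h x = f x"
    and le: "\<forall>\<^sub>F y in nhds x. g y \<le> f y \<and> f y \<le> h y"
  shows "(f has_derivative D) (at x)"
proof -
  have lim: "((\<lambda>y. ((g y - g x) - D (y - x)) /\<^sub>R norm (y - x)) \<longlongrightarrow> 0) (at x)"
    "((\<lambda>y. ((h y - h x) - D (y - x)) /\<^sub>R norm (y - x)) \<longlongrightarrow> 0) (at x)"
    using g h by (auto simp: has_derivative_at_within)
  have ev: "\<forall>\<^sub>F y in at x. g y \<le> f y \<and> f y \<le> h y"
    using le unfolding eventually_at_filter by (rule eventually_mono) simp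
  have "((\<lambda>y. ((f y - f x) - D (y - x)) /\<^sub>R norm (y - x)) \<longlongrightarrow> 0) (at x)"
  proof (rule tendsto_sandwich[OF _ _ lim])
    show "\<forall>\<^sub>F y in at x. ((g y - g x) - D (y - x)) /\<^sub>R norm (y - x)
        \<le> ((f y - f x) - D (y - x)) /\<^sub>R norm (y - x)"
      using ev by (rule eventually_mono) (auto simp: eq intro!: mult_left_mono)
    show "\<forall>\<^sub>F y in at x. ((f y - f x) - D (y - x)) /\<^sub>R norm (y - x)
        \<le> ((h y - h x) - D (y - x)) /\<^sub>R norm (y - x)"
      using ev by (rule eventually_mono) (auto simp: eq intro!: mult_left_mono)
  qed
  then show ?thesis
    using g by (simp add: has_derivative_at_within)
qed

lemma eventually_snd_pos:
  assumes "0 < snd u"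
  shows "\<forall>\<^sub>F v in nhds u. 0 < snd (v :: 'a::topological_space \<times> real)"
proof -
  have "open (UNIV \<times> {0::real<..})"
    by (intro open_Times) auto
  then have "\<forall>\<^sub>F v in nhds u. v \<in> UNIV \<times> {0<..}"
    using assms by (intro eventually_nhds_in_open) (auto simp: mem_Times_iff)
  then show ?thesis
    by (rule eventually_mono) auto
qed

lemma has_egradient_rls_value:
  fixes A :: "real^'n^'m"
  assumes R: "eproper R" "econvex_on UNIV R"
    and l: "0 < l" and sol: "rls_solution A R b l x"
  shows "has_egradient (rls_value A R) (b - A *v x, real_of_ereal (R x)) (b, l)"
proof -
  obtain a where a: "R x = ereal a"
    using rls_solution_finite[OF R(1) sol l] .
  define r where "r = b - A *v x"
  define hi where "hi = (\<lambda>u. 1/2 * ((fst u - A *v x) \<bullet> (fst u - A *v x)) + snd u * a)"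
  define e where "e = (\<lambda>u. (fst u - A *v x) - (snd u / l) *\<^sub>R r)"
  define lo where "lo = (\<lambda>u. hi u - 1/2 * (e u \<bullet> e u))"
  have "e (b, l) = 0"
    using l by (simp add: e_def r_def)
  have bounds: "rls_value A R u \<le> ereal (hi u)" "ereal (lo u) \<le> rls_value A R u"
    if "0 < snd u" for u
    using rls_value_bounds[OF R l sol a that, of "fst u"]
    by (simp_all add: hi_def lo_def e_def r_def power2_norm_eq_inner)
  have ev: "\<forall>\<^sub>F u in nhds (b, l). 0 < snd u"
    using l by (intro eventually_snd_pos) simp
  have fin: "\<bar>rls_value A R u\<bar> \<noteq> \<infinity>" if "0 < snd u" for u
    using bounds[OF that] by (cases "rls_value A R u") auto
  have le: "lo u \<le> real_of_ereal (rls_value A R u) \<and> real_of_ereal (rls_value A R u) \<le> hi u"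
    if "0 < snd u" for u
    using bounds[OF that] by (cases "rls_value A R u") auto
  have d_hi: "(hi has_derivative (\<lambda>h. h \<bullet> (r, a))) (at (b, l))"
    unfolding hi_def
    by (auto intro!: derivative_eq_intros ext simp: r_def inner_prod_def inner_commute algebra_simps)
  have "(e has_derivative (\<lambda>h. fst h - (snd h / l) *\<^sub>R r)) (at (b, l))"
    unfolding e_def using l by (auto intro!: derivative_eq_intros)
  then have "(lo has_derivative (\<lambda>h. h \<bullet> (r, a) - 1/2 * (e (b, l) \<bullet> (fst h - (snd h / l) *\<^sub>R r)
      + (fst h - (snd h / l) *\<^sub>R r) \<bullet> e (b, l)))) (at (b, l))"
    unfolding lo_def by (intro d_hi has_derivative_diff has_derivative_mult_right has_derivative_inner)
  then have d_lo: "(lo has_derivative (\<lambda>h. h \<bullet> (r, a))) (at (b, l))"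
    by (simp add: \<open>e (b, l) = 0\<close>)
  have "lo (b, l) = hi (b, l)"
    by (simp add: lo_def \<open>e (b, l) = 0\<close>)
  then have "((\<lambda>u. real_of_ereal (rls_value A R u)) has_derivative (\<lambda>h. h \<bullet> (r, a))) (at (b, l))"
    using le[of "(b, l)"] l
    by (intro has_derivative_sandwich[OF d_lo d_hi] eventually_mono[OF ev le]) auto
  then show ?thesis
    unfolding has_egradient_def gderiv_def using eventually_mono[OF ev fin]
    by (simp add: a r_def)
qed

text \<open>The scaled residual \<open>(b - A x) / l\<close> depends on the parameters in a locally Lipschitz way, by
  monotonicity of the subdifferential.\<close>

lemma rls_solution_scaled_residual:
  fixes A :: "real^'n^'m"
  assumes R: "eproper R" "econvex_on UNIV R" and l: "0 < l" "0 < l'"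
    and sol: "rls_solution A R b l x" "rls_solution A R b' l' x'"
  defines "y \<equiv> (b - A *v x) /\<^sub>R l" and "y' \<equiv> (b' - A *v x') /\<^sub>R l'"
  shows "norm (y - y') \<le> norm (b - b' - (l - l') *\<^sub>R y') / l"
proof -
  obtain a a' where a: "R x = ereal a" "R x' = ereal a'"
    using rls_solution_finite[OF R(1)] sol l by metis
  let ?w = "A *v x - A *v x'" and ?d = "b - b' - (l - l') *\<^sub>R y'"
  have "a + y \<bullet> (- ?w) \<le> a'" "a' + y' \<bullet> ?w \<le> a"
    using rls_solution_subgradient[OF R(2) l(1) sol(1) a]
      rls_solution_subgradient[OF R(2) l(2) sol(2) a(2,1)]
    by (simp_all add: y_def y'_def)
  then have mono: "0 \<le> (y - y') \<bullet> ?w"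
    by (simp add: inner_diff_left inner_diff_right)
  have "?w = ?d - l *\<^sub>R (y - y')"
    using l by (simp add: y_def y'_def algebra_simps)
  then have "l * (norm (y - y'))\<^sup>2 \<le> (y - y') \<bullet> ?d"
    using mono by (simp add: inner_diff_right power2_norm_eq_inner)
  also have "\<dots> \<le> norm (y - y') * norm ?d"
    by (rule norm_cauchy_schwarz)
  finally have "norm (y - y') * (l * norm (y - y')) \<le> norm (y - y') * norm ?d"
    by (simp add: power2_eq_square mult.left_commute)
  then have "l * norm (y - y') \<le> norm ?d"
    using l by (cases "y = y'") auto
  then show ?thesis
    using l by (simp add: field_simps)
qed

lemma rls_solution_unique_values:
  fixes A :: "real^'n^'m"
  assumes R: "eproper R" "econvex_on UNIV R" and l: "0 < l"
    and sol: "rls_solution A R b l x" "rls_solution A R b l x'"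
  shows "A *v x = A *v x'" "R x = R x'"
proof -
  show eq: "A *v x = A *v x'"
    using rls_solution_scaled_residual[OF R l l sol] l by simp
  obtain a a' where a: "R x = ereal a" "R x' = ereal a'"
    using rls_solution_finite[OF R(1)] sol l by metis
  show "R x = R x'"
    using rls_solution_subgradient[OF R(2) l sol(1) a]
      rls_solution_subgradient[OF R(2) l sol(2) a(2,1)] by (simp add: eq a)
qed

lemma continuously_differentiable_rls_value:
  fixes A :: "real^'n^'m"
  assumes R: "eproper R" "econvex_on UNIV R"
    and U: "U \<subseteq> UNIV \<times> {0<..}" and ex: "\<forall>(b, l)\<in>U. \<exists>x. rls_solution A R b l x"
  shows "continuously_differentiable_on U (rls_value A R)"
proof -
  have "\<forall>u\<in>U. \<exists>x. rls_solution A R (fst u) (snd u) x"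
    using ex by auto
  then obtain x where x: "\<And>u. u \<in> U \<Longrightarrow> rls_solution A R (fst u) (snd u) (x u)"
    by metis
  have pos: "0 < snd u" if "u \<in> U" for u
    using U that by auto
  define a where "a u = real_of_ereal (R (x u))" for u
  define y where "y u = (fst u - A *v x u) /\<^sub>R snd u" for u
  have a: "R (x u) = ereal (a u)" if "u \<in> U" for u
    using rls_solution_finite[OF R(1) x pos] that by (metis a_def real_of_ereal.simps(1))
  have Ax: "A *v x u = fst u - snd u *\<^sub>R y u" if "u \<in> U" for u
    using pos[OF that] by (simp add: y_def)
  have evU: "\<forall>\<^sub>F u in at u' within U. u \<in> U" for u'
    by (simp add: eventually_at_filter)
  have y: "(y \<longlongrightarrow> y u') (at u' within U)" if u': "u' \<in> U" for u'
  proof -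
    let ?e = "\<lambda>u. norm (fst u - fst u' - (snd u - snd u') *\<^sub>R y u') / snd u"
    have "(?e \<longlongrightarrow> norm (fst u' - fst u' - (snd u' - snd u') *\<^sub>R y u') / snd u') (at u' within U)"
      using pos[OF u'] by (intro tendsto_intros) auto
    then have "(?e \<longlongrightarrow> 0) (at u' within U)"
      by simp
    moreover have "\<forall>\<^sub>F u in at u' within U. norm (y u - y u') \<le> ?e u"
    proof (rule eventually_mono[OF evU])
      fix u assume u: "u \<in> U"
      show "norm (y u - y u') \<le> ?e u"
        using rls_solution_scaled_residual[OF R pos[OF u] pos[OF u'] x[OF u] x[OF u']]
        by (simp add: y_def)
    qed
    ultimately have "((\<lambda>u. y u - y u') \<longlongrightarrow> 0) (at u' within U)"
      by (rule Lim_null_comparison[rotated])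
    then show ?thesis
      by (simp add: LIM_zero_iff)
  qed
  have lim_Ax: "((\<lambda>u. A *v x u) \<longlongrightarrow> A *v x u') (at u' within U)" if u': "u' \<in> U" for u'
  proof -
    have "((\<lambda>u. fst u - snd u *\<^sub>R y u) \<longlongrightarrow> fst u' - snd u' *\<^sub>R y u') (at u' within U)"
      by (intro tendsto_intros y u')
    then show ?thesis
      unfolding Ax[OF u', symmetric]
      by (rule Lim_transform_eventually) (rule eventually_mono[OF evU], simp add: Ax)
  qed
  have lim_a: "(a \<longlongrightarrow> a u') (at u' within U)" if u': "u' \<in> U" for u'
  proof -
    let ?w = "\<lambda>u. A *v x u - A *v x u'"
    have "((\<lambda>u. a u' + y u' \<bullet> ?w u) \<longlongrightarrow> a u' + y u' \<bullet> ?w u') (at u' within U)"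
      "((\<lambda>u. a u' + y u \<bullet> ?w u) \<longlongrightarrow> a u' + y u' \<bullet> ?w u') (at u' within U)"
      by (intro tendsto_intros y lim_Ax u')+
    then have lims: "((\<lambda>u. a u' + y u' \<bullet> ?w u) \<longlongrightarrow> a u') (at u' within U)"
      "((\<lambda>u. a u' + y u \<bullet> ?w u) \<longlongrightarrow> a u') (at u' within U)"
      by simp_all
    have "a u' + y u' \<bullet> ?w u \<le> a u" if "u \<in> U" for u
      using rls_solution_subgradient[OF R(2) pos[OF u'] x[OF u'] a[OF u'] a[OF that]]
      by (simp add: y_def)
    moreover have "a u \<le> a u' + y u \<bullet> ?w u" if "u \<in> U" for u
      using rls_solution_subgradient[OF R(2) pos[OF that] x[OF that] a[OF that] a[OF u']]
      by (simp add: y_def inner_diff_right algebra_simps)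
    ultimately show ?thesis
      by (intro tendsto_sandwich[OF _ _ lims] eventually_mono[OF evU]) auto
  qed
  let ?g = "\<lambda>u. (fst u - A *v x u, a u)"
  have "has_egradient (rls_value A R) (?g u) u" if "u \<in> U" for u
    using has_egradient_rls_value[OF R pos[OF that] x[OF that]] by (simp add: a_def)
  moreover have "continuous_on U ?g"
    unfolding continuous_on_def by (intro ballI tendsto_intros lim_Ax lim_a)
  ultimately show ?thesis
    unfolding continuously_differentiable_on_def by (intro exI[of _ ?g]) auto
qed

section \<open>Convexity and concavity of the value function\<close>

lemma econvex_on_rls_value:
  fixes A :: "real^'n^'m"
  assumes "econvex_on UNIV R" "0 \<le> l"
  shows "econvex_on UNIV (\<lambda>b. rls_value A R (b, l))"
  unfolding econvex_on_def convex_alt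
proof (intro ballI allI impI)
  fix p q and t :: real
  assume pq: "p \<in> eepi UNIV (\<lambda>b. rls_value A R (b, l))" "q \<in> eepi UNIV (\<lambda>b. rls_value A R (b, l))"
    and t: "0 \<le> t \<and> t \<le> 1"
  obtain b r c s where [simp]: "p = (b, r)" "q = (c, s)"
    by (cases p; cases q)
  \<comment> \<open>the infimum need not be attained, so approximate minimizers are combined\<close>
  have near: "\<exists>x. rls_objective A R b l x \<le> ereal (r + e)"
    if "rls_value A R (b, l) \<le> ereal r" "0 < e" for b r e
  proof -
    have "rls_value A R (b, l) < ereal (r + e)"
      using that by (meson ereal_less_add le_less_trans less_add_same_cancel1 less_ereal.simps(1))
    then show ?thesis
      unfolding rls_value_def by (auto simp: INF_less_iff intro: less_imp_le)
  qed
  let ?d = "(1 - t) *\<^sub>R b + t *\<^sub>R c"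
  have "rls_value A R (?d, l) \<le> ereal ((1 - t) * r + t * s)"
  proof (rule ereal_le_epsilon2)
    fix e :: real assume e: "0 < e"
    obtain x y where xy: "rls_objective A R b l x \<le> ereal (r + e)"
        "rls_objective A R c l y \<le> ereal (s + e)"
      using near[of b r e] near[of c s e] pq e by (auto simp: eepi_def)
    have "rls_objective A R ?d l ((1 - t) *\<^sub>R x + t *\<^sub>R y)
        \<le> ereal ((1 - t) * (r + e) + t * (s + e))"
      using t by (intro rls_objective_jointly_convex[OF assms xy]) auto
    then have "rls_value A R (?d, l) \<le> ereal ((1 - t) * (r + e) + t * (s + e))"
      using rls_value_le order_trans by blast
    then show "rls_value A R (?d, l) \<le> ereal ((1 - t) * r + t * s) + ereal e"
      by (simp add: algebra_simps)
  qed
  then show "(1 - t) *\<^sub>R p + t *\<^sub>R q \<in> eepi UNIV (\<lambda>b. rls_value A R (b, l))"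
    by (simp add: eepi_def)
qed

text \<open>For fixed \<open>x\<close> the objective is concave in the regularization parameter, also up to
  \<open>0\<close>: it is affine if \<open>R x\<close> is finite, and otherwise it is \<open>\<infinity>\<close> on the positive reals,
  whatever its value at \<open>0\<close>.\<close>

lemma econcave_on_rls_value:
  fixes A :: "real^'n^'m"
  assumes R: "eproper R"
  shows "econcave_on {0..} (\<lambda>l. rls_value A R (b, l))"
  unfolding econcave_on_def econvex_on_def convex_alt
proof (intro ballI allI impI)
  fix p q and t :: real
  assume pq: "p \<in> eepi {0..} (\<lambda>l. - rls_value A R (b, l))" "q \<in> eepi {0..} (\<lambda>l. - rls_value A R (b, l))"
    and t: "0 \<le> t \<and> t \<le> 1"
  obtain l1 r1 l2 r2 where [simp]: "p = (l1, r1)" "q = (l2, r2)"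
    by (cases p; cases q)
  have l: "0 \<le> l1" "0 \<le> l2" and "- rls_value A R (b, l1) \<le> ereal r1" "- rls_value A R (b, l2) \<le> ereal r2"
    using pq by (auto simp: eepi_def)
  then have "ereal (- r1) \<le> rls_value A R (b, l1)" "ereal (- r2) \<le> rls_value A R (b, l2)"
    by (metis ereal_minus_le_minus ereal_uminus_uminus uminus_ereal.simps(1))+
  then have le: "ereal (- r1) \<le> rls_objective A R b l1 x" "ereal (- r2) \<le> rls_objective A R b l2 x" for x
    using rls_value_le order_trans by blast+
  show "(1 - t) *\<^sub>R p + t *\<^sub>R q \<in> eepi {0..} (\<lambda>l. - rls_value A R (b, l))"
  proof (cases "t = 0 \<or> t = 1")
    case True
    then show ?thesis
      using pq by auto
  next
    case False
    then have t': "0 < t" "t < 1"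
      using t by auto
    let ?l = "(1 - t) * l1 + t * l2"
    have "ereal ((1 - t) * (- r1) + t * (- r2)) \<le> rls_objective A R b ?l x" for x
      using R
    proof (cases rule: eproper_cases[where x = x])
      case (real c)
      let ?q = "1/2 * (norm (A *v x - b))\<^sup>2"
      have "- r1 \<le> ?q + l1 * c" "- r2 \<le> ?q + l2 * c"
        using le[of x] by (simp_all add: rls_objective_real[of R x, OF real])
      then have "(1 - t) * (- r1) + t * (- r2) \<le> (1 - t) * (?q + l1 * c) + t * (?q + l2 * c)"
        using t by (intro add_mono mult_left_mono) auto
      also have "\<dots> = ?q + ?l * c"
        by (simp add: field_simps)
      finally show ?thesis
        by (simp add: rls_objective_real[of R x, OF real])
    next
      case infinite
      show ?thesis
        \<comment> \<open>at \<open>0\<close> the objective is finite if \<open>x\<close> is in the closure of the domain\<close>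
      proof (cases "l1 = 0 \<and> l2 = 0")
        case True
        show ?thesis
        proof (cases "rls_objective A R b 0 x")
          case (real v)
          then have "- r1 \<le> v" "- r2 \<le> v"
            using le[of x] True by simp_all
          then have "(1 - t) * (- r1) + t * (- r2) \<le> (1 - t) * v + t * v"
            using t by (intro add_mono mult_left_mono) auto
          then show ?thesis
            using True real by (simp add: algebra_simps)
        qed (use le[of x] True in auto)
      next
        case False
        then have "0 < ?l"
          using l t' by (metis add_nonneg_pos add_pos_nonneg diff_gt_0_iff_gt less_eq_real_def
              mult_nonneg_nonneg mult_pos_pos)
        then show ?thesis
          by (simp add: rls_objective_infinite[of R x, OF infinite])
      qed
    qed
    then have "ereal ((1 - t) * (- r1) + t * (- r2)) \<le> rls_value A R (b, ?l)"
      by (rule rls_value_geI)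
    then have "- rls_value A R (b, ?l) \<le> - ereal ((1 - t) * (- r1) + t * (- r2))"
      by (simp only: ereal_minus_le_minus)
    then have "- rls_value A R (b, ?l) \<le> ereal ((1 - t) * r1 + t * r2)"
      by (simp add: algebra_simps)
    then show ?thesis
      using l t by (simp add: eepi_def)
  qed
qed

section \<open>Continuity at the boundary\<close>

lemma INF_half_dist_sq:
  fixes A :: "real^'n^'m"
  assumes "S \<noteq> {}"
  shows "(INF x\<in>S. ereal (1/2 * (norm (A *v x - b))\<^sup>2)) = ereal (1/2 * (infdist b ((*v) A ` S))\<^sup>2)"
proof (rule antisym)
  let ?T = "(*v) A ` S"
  let ?m = "INF x\<in>S. ereal (1/2 * (norm (A *v x - b))\<^sup>2)"
  have "closure ?T \<noteq> {}"
    using assms by simp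
  then obtain z where z: "z \<in> closure ?T" "infdist b (closure ?T) = dist b z"
    using infdist_attains_inf[of "closure ?T" b] by auto
  have "closed {w. ?m \<le> ereal (1/2 * (norm (w - b))\<^sup>2)}"
    by (intro closed_Collect_le continuous_intros)
  moreover have "?T \<subseteq> {w. ?m \<le> ereal (1/2 * (norm (w - b))\<^sup>2)}"
    by (auto intro: INF_lower2)
  ultimately have "closure ?T \<subseteq> {w. ?m \<le> ereal (1/2 * (norm (w - b))\<^sup>2)}"
    by (rule closure_minimal[rotated])
  then have "?m \<le> ereal (1/2 * (norm (z - b))\<^sup>2)"
    using z by blast
  also have "norm (z - b) = infdist b ?T"
    using z(2) by (simp add: infdist_eq_setdist dist_norm norm_minus_commute)
  finally show "?m \<le> ereal (1/2 * (infdist b ?T)\<^sup>2)" .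
next
  show "ereal (1/2 * (infdist b ((*v) A ` S))\<^sup>2) \<le> (INF x\<in>S. ereal (1/2 * (norm (A *v x - b))\<^sup>2))"
  proof (rule INF_greatest)
    fix x assume "x \<in> S"
    then have "infdist b ((*v) A ` S) \<le> norm (A *v x - b)"
      by (metis dist_commute dist_norm image_eqI infdist_le)
    then show "ereal (1/2 * (infdist b ((*v) A ` S))\<^sup>2) \<le> ereal (1/2 * (norm (A *v x - b))\<^sup>2)"
      using infdist_nonneg[of b] by (simp add: power_mono)
  qed
qed

text \<open>An affine minorant of \<open>R\<close> with slope \<open>A\<^sup>T v\<close> can be absorbed into the quadratic term by a
  shift of \<open>b\<close>.\<close>

lemma rls_value_ge_shifted_dist:
  fixes A :: "real^'n^'m"
  assumes R: "eproper R" and minorant: "\<And>x. ereal (v \<bullet> (A *v x) - c) \<le> R x" and l: "0 \<le> l"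
  shows "ereal (1/2 * (infdist (b - l *\<^sub>R v) ((*v) A ` closure (edom R)))\<^sup>2
      + l * (v \<bullet> b) - 1/2 * l\<^sup>2 * (norm v)\<^sup>2 - l * c) \<le> rls_value A R (b, l)"
    (is "ereal ?lb \<le> _")
proof (rule rls_value_geI)
  fix x
  show "ereal ?lb \<le> rls_objective A R b l x"
  proof (cases "x \<in> closure (edom R)")
    case False
    then have "x \<notin> edom R"
      using closure_subset by blast
    then have "rls_objective A R b l x = \<infinity>"
      using False l
      by (cases "l = 0") (auto simp: rls_objective_def escale_def set_indicator_def edom_def)
    then show ?thesis
      by simp
  next
    case True
    have "infdist (b - l *\<^sub>R v) ((*v) A ` closure (edom R)) \<le> dist (b - l *\<^sub>R v) (A *v x)"
      using True by (intro infdist_le) auto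
    also have "\<dots> = norm ((A *v x - b) + l *\<^sub>R v)"
      by (simp add: dist_norm norm_minus_commute algebra_simps)
    finally have "(infdist (b - l *\<^sub>R v) ((*v) A ` closure (edom R)))\<^sup>2 \<le> (norm ((A *v x - b) + l *\<^sub>R v))\<^sup>2"
      using infdist_nonneg by (intro power_mono)
    then have le: "?lb \<le> 1/2 * (norm (A *v x - b))\<^sup>2 + l * (v \<bullet> (A *v x) - c)"
      unfolding norm_sq_add_scaleR
      by (simp add: inner_diff_left inner_commute algebra_simps)
    show ?thesis
    proof (cases "l = 0")
      case l0: True
      then show ?thesis
        using le True by (simp add: rls_objective_def escale_def set_indicator_def)
    next
      case False
      show ?thesis
        using R
      proof (cases rule: eproper_cases[where x = x])
        case (real r)
        then have "l * (v \<bullet> (A *v x) - c) \<le> l * r"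
          using minorant[of x] l by (intro mult_left_mono) auto
        then show ?thesis
          using le by (simp add: rls_objective_real[of R x, OF real])
      next
        case infinite
        then show ?thesis
          using l False by (simp add: rls_objective_infinite)
      qed
    qed
  qed
qed

lemma conjugate_finite_minorant:
  assumes "eproper f" "y \<in> edom (conjugate f)"
  shows "\<exists>c. \<forall>x. ereal (y \<bullet> x - c) \<le> f x"
proof -
  obtain c where c: "conjugate f y \<le> ereal c"
    using assms(2) unfolding edom_def by (metis ereal_dense2 less_imp_le mem_Collect_eq)
  have "ereal (y \<bullet> x - c) \<le> f x" for x
    using assms(1)
  proof (cases rule: eproper_cases[where x = x])
    case (real r)
    have "ereal (y \<bullet> x) - f x \<le> ereal c"
      using c unfolding conjugate_def by (auto simp: SUP_le_iff)
    then show ?thesis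
      by (simp add: real)
  qed simp
  then show ?thesis
    by blast
qed

lemma rls_value_tendsto_boundary:
  fixes A :: "real^'n^'m"
  assumes R: "eproper R"
    and y: "range (\<lambda>y. transpose A *v y) \<inter> edom (conjugate R) \<noteq> {}"
  shows "(rls_value A R \<longlongrightarrow> (INF x\<in>closure (edom R). ereal (1/2 * (norm (A *v x - b))\<^sup>2)))
    (at (b, 0) within UNIV \<times> {0..})"
proof (rule order_tendstoI)
  let ?F = "at (b, 0::real) within UNIV \<times> {0..}"
  let ?S = "closure (edom R)"
  have ne: "?S \<noteq> {}"
    using R by (auto simp: eproper_def)
  obtain v where v: "transpose A *v v \<in> edom (conjugate R)"
    using y by auto
  obtain c where "\<forall>x. ereal ((transpose A *v v) \<bullet> x - c) \<le> R x"
    using conjugate_finite_minorant[OF R v] by blast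
  then have minorant: "ereal (v \<bullet> (A *v x) - c) \<le> R x" for x
    by (simp add: dot_lmul_matrix)
  have id: "((\<lambda>u. u) \<longlongrightarrow> (b, 0)) ?F"
    by (rule tendsto_ident_at)
  have fst: "(fst \<longlongrightarrow> b) ?F" and snd: "(snd \<longlongrightarrow> 0) ?F"
    using tendsto_fst[OF id] tendsto_snd[OF id] by simp_all
  have ev: "\<forall>\<^sub>F u in ?F. u \<in> UNIV \<times> {0..}"
    by (simp add: eventually_at_filter)
  {
    fix a assume a: "a < (INF x\<in>?S. ereal (1/2 * (norm (A *v x - b))\<^sup>2))"
    define lb where "lb u = 1/2 * (infdist (fst u - snd u *\<^sub>R v) ((*v) A ` ?S))\<^sup>2
      + snd u * (v \<bullet> fst u) - 1/2 * (snd u)\<^sup>2 * (norm v)\<^sup>2 - snd u * c" for u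
    have "(lb \<longlongrightarrow> 1/2 * (infdist (b - 0 *\<^sub>R v) ((*v) A ` ?S))\<^sup>2
        + 0 * (v \<bullet> b) - 1/2 * 0\<^sup>2 * (norm v)\<^sup>2 - 0 * c) ?F"
      unfolding lb_def by (intro tendsto_intros fst snd)
    then have "((\<lambda>u. ereal (lb u)) \<longlongrightarrow> (INF x\<in>?S. ereal (1/2 * (norm (A *v x - b))\<^sup>2))) ?F"
      unfolding INF_half_dist_sq[OF ne] by simp
    then have "\<forall>\<^sub>F u in ?F. a < ereal (lb u)"
      using a by (rule order_tendstoD)
    then show "\<forall>\<^sub>F u in ?F. a < rls_value A R u"
    proof (rule eventually_elim2[OF _ ev])
      fix u assume "a < ereal (lb u)" "u \<in> UNIV \<times> {0::real..}"
      moreover have "ereal (lb u) \<le> rls_value A R (fst u, snd u)"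
        using calculation(2) unfolding lb_def
        by (intro rls_value_ge_shifted_dist[OF R minorant]) auto
      ultimately show "a < rls_value A R u"
        by simp
    qed
  next
    fix a assume "(INF x\<in>?S. ereal (1/2 * (norm (A *v x - b))\<^sup>2)) < a"
    then obtain z where z: "z \<in> ?S" "ereal (1/2 * (norm (A *v z - b))\<^sup>2) < a"
      by (auto simp: INF_less_iff)
    \<comment> \<open>the infimum may be approached within the domain itself\<close>
    have "open {x. ereal (1/2 * (norm (A *v x - b))\<^sup>2) < a}"
      by (intro open_Collect_less continuous_intros)
    then have "{x. ereal (1/2 * (norm (A *v x - b))\<^sup>2) < a} \<inter> edom R \<noteq> {}"
      using z open_Int_closure_eq_empty[of "{x. ereal (1/2 * (norm (A *v x - b))\<^sup>2) < a}" "edom R"]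
      by blast
    then obtain x where x: "x \<in> edom R" "ereal (1/2 * (norm (A *v x - b))\<^sup>2) < a"
      by blast
    obtain r where r: "R x = ereal r"
      using eproper_cases[OF R, of x] x(1) by (auto simp: edom_def)
    have "((\<lambda>u. ereal (1/2 * (norm (A *v x - fst u))\<^sup>2 + snd u * r))
        \<longlongrightarrow> ereal (1/2 * (norm (A *v x - b))\<^sup>2 + 0 * r)) ?F"
      by (intro tendsto_intros fst snd)
    then have "\<forall>\<^sub>F u in ?F. ereal (1/2 * (norm (A *v x - fst u))\<^sup>2 + snd u * r) < a"
      using x(2) by (intro order_tendstoD) auto
    then show "\<forall>\<^sub>F u in ?F. rls_value A R u < a"
    proof (rule eventually_mono)
      fix u assume "ereal (1/2 * (norm (A *v x - fst u))\<^sup>2 + snd u * r) < a"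
      then show "rls_value A R u < a"
        using rls_value_le[of A R "fst u" "snd u" x]
        by (simp add: rls_objective_real[of R x, OF r])
    qed
  }
qed

section \<open>The value function of regularized least squares\<close>

theorem proposition3p1:
  fixes A :: "real^'n^'m" and R :: "real^'n \<Rightarrow> ereal"
  assumes "eproper R" and "eclosed R" and "econvex_on UNIV R"
  shows
    "((\<forall>x. A *v x = 0 \<and> x \<noteq> 0 \<longrightarrow> recession R x > 0) \<longrightarrow>
        (\<forall>b. \<forall>l>0. \<exists>x. rls_solution A R b l x))
     \<and>
     (\<forall>bb lb xb. lb > 0 \<and> rls_solution A R bb lb xb \<longrightarrow>
        has_egradient (rls_value A R) (bb - A *v xb, real_of_ereal (R xb)) (bb, lb) \<and>
        (\<forall>U. (bb, lb) \<in> interior U \<and> U \<subseteq> UNIV \<times> {0<..} \<and>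
             (\<forall>(b, l)\<in>U. \<exists>x. rls_solution A R b l x) \<longrightarrow>
             continuously_differentiable_on U (rls_value A R)))
     \<and>
     (range (\<lambda>y. transpose A *v y) \<inter> edom (conjugate R) \<noteq> {} \<longrightarrow>
        (\<forall>bb. (rls_value A R \<longlongrightarrow>
                (INF x\<in>closure (edom R). ereal (1/2 * (norm (A *v x - bb))\<^sup>2)))
              (at (bb, 0) within UNIV \<times> {0..})))
     \<and>
     (\<forall>l\<ge>0. econvex_on UNIV (\<lambda>b. rls_value A R (b, l)))
     \<and>
     (\<forall>b. econcave_on {0..} (\<lambda>l. rls_value A R (b, l)))
     \<and>
     (\<forall>bb lb x1 x2. lb > 0 \<and> rls_solution A R bb lb x1 \<and> rls_solution A R bb lb x2 \<longrightarrow>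
        bb - A *v x1 = bb - A *v x2 \<and> R x1 = R x2)"
proof (intro conjI allI impI)
  show "\<exists>x. rls_solution A R b l x"
    if "\<forall>x. A *v x = 0 \<and> x \<noteq> 0 \<longrightarrow> recession R x > 0" "0 < l" for b l
    using that by (intro rls_solution_exists assms) auto
next
  show "has_egradient (rls_value A R) (bb - A *v xb, real_of_ereal (R xb)) (bb, lb)"
    if "lb > 0 \<and> rls_solution A R bb lb xb" for bb lb xb
    using that by (intro has_egradient_rls_value assms) auto
next
  show "continuously_differentiable_on U (rls_value A R)"
    if "(bb, lb) \<in> interior U \<and> U \<subseteq> UNIV \<times> {0<..} \<and> (\<forall>(b, l)\<in>U. \<exists>x. rls_solution A R b l x)"
    for bb lb U
    using that by (intro continuously_differentiable_rls_value assms) auto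
next
  show "(rls_value A R \<longlongrightarrow> (INF x\<in>closure (edom R). ereal (1/2 * (norm (A *v x - bb))\<^sup>2)))
      (at (bb, 0) within UNIV \<times> {0..})"
    if "range (\<lambda>y. transpose A *v y) \<inter> edom (conjugate R) \<noteq> {}" for bb
    using that by (intro rls_value_tendsto_boundary assms)
next
  show "econvex_on UNIV (\<lambda>b. rls_value A R (b, l))" if "0 \<le> l" for l
    using that by (intro econvex_on_rls_value assms)
next
  show "econcave_on {0..} (\<lambda>l. rls_value A R (b, l))" for b
    by (intro econcave_on_rls_value assms)
next
  fix bb lb x1 x2
  assume "lb > 0 \<and> rls_solution A R bb lb x1 \<and> rls_solution A R bb lb x2"
  then have l: "0 < lb" and sol: "rls_solution A R bb lb x1" "rls_solution A R bb lb x2"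
    by auto
  show "bb - A *v x1 = bb - A *v x2" "R x1 = R x2"
    using rls_solution_unique_values[OF assms(1,3) l sol] by simp_all
qed

end
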